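(* Let $\mathbf F$ be an infinite spherically complete field with a nontrivial non-Archimedean valuation, let $E,H$ be normed spaces over $\mathbf F$, and $1\le r\le\infty$. If $T\in L_r(E,H)$, then $T^*\in L_r(H^*,E^* )$ and $\nu_r(T^* )\le\nu_r(T)$.
   Context: $E^*$ is the space of continuous linear functionals on $E$; $T^*:H^*\to E^*$ is the adjoint, $(T^*b)(x)=b(Tx)$. $L(E,H)$ is the space of bounded linear operators with the operator norm. For $1\le r<\infty$, $L_r(E,H)$ is the set of $A\in L(E,H)$ of the form $Ax=\sum_{n=1}^\infty a_n(x)y_n$ for all $x\in E$, with $a_n\in E^*$, $y_n\in H$ and $\sum_{n=1}^\infty\|a_n\|_{E^*}^r\|y_n\|_H^r<\infty$, and $\nu_r(A)=\inf\{\sum_n\|a_n\|^r_{E^*}\|y_n\|_H^r\}^{1/r}$ over all such representations; $L_\infty(E,H):=L(E,H)$ and $\nu_\infty(A)=\|A\|$. *)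

theory Defs
  imports Complex_Main "HOL-Library.Extended_Real" "HOL-Library.Function_Algebras"
begin

section \<open>Fields with a non-Archimedean valuation\<close>

text \<open>Valuations are written multiplicatively, as real-valued absolute values.\<close>

locale nonarch_valued_field =
  fixes v :: "'f::field \<Rightarrow> real"
  assumes val_nonneg: "0 \<le> v a"
    and val_eq_0_iff: "v a = 0 \<longleftrightarrow> a = 0"
    and val_mult: "v (a * b) = v a * v b"
    and val_ultra: "v (a + b) \<le> max (v a) (v b)"

definition nontrivial_valuation :: "('f::field \<Rightarrow> real) \<Rightarrow> bool" where
  "nontrivial_valuation v \<longleftrightarrow> (\<exists>a. a \<noteq> 0 \<and> v a \<noteq> 1)"

definition val_cball :: "('f::field \<Rightarrow> real) \<Rightarrow> 'f \<Rightarrow> real \<Rightarrow> 'f set" where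
  "val_cball v c \<rho> = {a. v (a - c) \<le> \<rho>}"

definition spherically_complete :: "('f::field \<Rightarrow> real) \<Rightarrow> bool" where
  "spherically_complete v \<longleftrightarrow>
     (\<forall>c \<rho>. (\<forall>n. 0 < \<rho> n) \<and> decseq (\<lambda>n::nat. val_cball v (c n) (\<rho> n))
        \<longrightarrow> (\<Inter>n. val_cball v (c n) (\<rho> n)) \<noteq> {})"

section \<open>Normed spaces\<close>

text \<open>
  A normed space is a linear subspace of an ambient vector space with a norm on it, so
  that duals (sets of functions) are again normed spaces in the same sense; a space that
  fills its whole type has carrier \<open>UNIV\<close>. Only the ordinary triangle inequality is
  required, so spaces with an ultrametric norm are included.
\<close>

record ('f, 'v) nspace =
  vecs :: "'v set"
  smul :: "'f \<Rightarrow> 'v \<Rightarrow> 'v"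
  nrm :: "'v \<Rightarrow> real"

definition normed_space :: "('f::field \<Rightarrow> real) \<Rightarrow> ('f, 'v::ab_group_add) nspace \<Rightarrow> bool" where
  "normed_space v E \<longleftrightarrow>
     vector_space (smul E) \<and> module.subspace (smul E) (vecs E) \<and>
     (\<forall>x\<in>vecs E. 0 \<le> nrm E x) \<and>
     (\<forall>x\<in>vecs E. nrm E x = 0 \<longleftrightarrow> x = 0) \<and>
     (\<forall>c. \<forall>x\<in>vecs E. nrm E (smul E c x) = v c * nrm E x) \<and>
     (\<forall>x\<in>vecs E. \<forall>y\<in>vecs E. nrm E (x + y) \<le> nrm E x + nrm E y)"

definition base_space :: "('f::field \<Rightarrow> real) \<Rightarrow> ('f, 'f) nspace" where
  "base_space v = \<lparr>vecs = UNIV, smul = (*), nrm = v\<rparr>"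

section \<open>Linear operators and duals\<close>

text \<open>
  Only the values on the carrier matter; the value 0 is prescribed outside it so that maps
  that agree on the carrier are equal.
\<close>

definition linear_maps ::
  "('f::field, 'v::ab_group_add) nspace \<Rightarrow> ('f, 'w::ab_group_add) nspace \<Rightarrow> ('v \<Rightarrow> 'w) set" where
  "linear_maps E H = {A.
     (\<forall>x\<in>vecs E. A x \<in> vecs H) \<and>
     (\<forall>x\<in>vecs E. \<forall>y\<in>vecs E. A (x + y) = A x + A y) \<and>
     (\<forall>c. \<forall>x\<in>vecs E. A (smul E c x) = smul H c (A x)) \<and>
     (\<forall>x. x \<notin> vecs E \<longrightarrow> A x = 0)}"

definition continuous_map_between ::
  "('f::field, 'v::ab_group_add) nspace \<Rightarrow> ('f, 'w::ab_group_add) nspace \<Rightarrow> ('v \<Rightarrow> 'w) \<Rightarrow> bool" where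
  "continuous_map_between E H A \<longleftrightarrow>
     (\<forall>x\<in>vecs E. \<forall>\<epsilon>>0. \<exists>\<delta>>0. \<forall>y\<in>vecs E. nrm E (y - x) < \<delta> \<longrightarrow> nrm H (A y - A x) < \<epsilon>)"

definition bounded_ops ::
  "('f::field, 'v::ab_group_add) nspace \<Rightarrow> ('f, 'w::ab_group_add) nspace \<Rightarrow> ('v \<Rightarrow> 'w) set" where
  "bounded_ops E H =
     {A \<in> linear_maps E H. \<exists>C. \<forall>x\<in>vecs E. nrm H (A x) \<le> C * nrm E x}"

text \<open>
  The convention \<open>0 / 0 = 0\<close> makes the term at \<open>x = 0\<close> vanish. The supremum is over all
  vectors: for a discrete valuation the supremum over the unit ball may be smaller.
\<close>

definition opnorm ::
  "('f::field, 'v::ab_group_add) nspace \<Rightarrow> ('f, 'w::ab_group_add) nspace \<Rightarrow> ('v \<Rightarrow> 'w) \<Rightarrow> real" where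
  "opnorm E H A = (SUP x\<in>vecs E. nrm H (A x) / nrm E x)"

definition dual ::
  "('f::field \<Rightarrow> real) \<Rightarrow> ('f, 'v::ab_group_add) nspace \<Rightarrow> ('f, 'v \<Rightarrow> 'f) nspace" where
  "dual v E = \<lparr>
     vecs = {f \<in> linear_maps E (base_space v). continuous_map_between E (base_space v) f},
     smul = (\<lambda>c f x. c * f x),
     nrm = opnorm E (base_space v)\<rparr>"

definition adjoint ::
  "('f::field \<Rightarrow> real) \<Rightarrow> ('f, 'w::ab_group_add) nspace \<Rightarrow> ('v \<Rightarrow> 'w) \<Rightarrow> ('w \<Rightarrow> 'f) \<Rightarrow> ('v \<Rightarrow> 'f)" where
  "adjoint v H T = (\<lambda>b. if b \<in> vecs (dual v H) then (\<lambda>x. b (T x)) else 0)"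

section \<open>The classes of \<open>r\<close>-nuclear operators\<close>

definition nuclear_rep ::
  "('f::field \<Rightarrow> real) \<Rightarrow> ('f, 'v::ab_group_add) nspace \<Rightarrow> ('f, 'w::ab_group_add) nspace \<Rightarrow> real
    \<Rightarrow> ('v \<Rightarrow> 'w) \<Rightarrow> (nat \<Rightarrow> 'v \<Rightarrow> 'f) \<Rightarrow> (nat \<Rightarrow> 'w) \<Rightarrow> bool" where
  "nuclear_rep v E H p A a y \<longleftrightarrow>
     (\<forall>n. a n \<in> vecs (dual v E)) \<and> (\<forall>n. y n \<in> vecs H) \<and>
     (\<forall>x\<in>vecs E. (\<lambda>N. nrm H (A x - (\<Sum>n<N. smul H (a n x) (y n)))) \<longlonglongrightarrow> 0) \<and>
     summable (\<lambda>n. nrm (dual v E) (a n) powr p * nrm H (y n) powr p)"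

definition nuclear_ops ::
  "('f::field \<Rightarrow> real) \<Rightarrow> ereal \<Rightarrow> ('f, 'v::ab_group_add) nspace \<Rightarrow> ('f, 'w::ab_group_add) nspace
    \<Rightarrow> ('v \<Rightarrow> 'w) set" where
  "nuclear_ops v r E H =
     (if r = \<infinity> then bounded_ops E H
      else {A \<in> bounded_ops E H. \<exists>a y. nuclear_rep v E H (real_of_ereal r) A a y})"

definition nu ::
  "('f::field \<Rightarrow> real) \<Rightarrow> ereal \<Rightarrow> ('f, 'v::ab_group_add) nspace \<Rightarrow> ('f, 'w::ab_group_add) nspace
    \<Rightarrow> ('v \<Rightarrow> 'w) \<Rightarrow> real" where
  "nu v r E H A =
     (if r = \<infinity> then opnorm E H A
      else (let p = real_of_ereal r in
        (Inf {(\<Sum>n. nrm (dual v E) (a n) powr p * nrm H (y n) powr p) | a y.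
                nuclear_rep v E H p A a y}) powr (1 / p)))"

end

theory Submission
  imports Defs
begin

text \<open>
  If \<open>T x = \<Sum>n. a\<^sub>n(x) y\<^sub>n\<close>, then for every functional \<open>b\<close> on \<open>H\<close> formally
  \<open>T\<^sup>* b = \<Sum>n. b(y\<^sub>n) a\<^sub>n\<close>. So \<open>T\<^sup>*\<close> should be represented by the evaluations \<open>b \<mapsto> b(y\<^sub>n)\<close>,
  which lie in the bidual of \<open>H\<close> and have norm at most \<open>\<parallel>y\<^sub>n\<parallel>\<close>, together with the vectors
  \<open>a\<^sub>n\<close> of the dual of \<open>E\<close>. The sum attached to this representation is at most the one attached
  to the given representation of \<open>T\<close>, and passing to infima gives the inequality of norms.

  The one point that needs an argument is that the series for \<open>T\<^sup>* b\<close> converges in the norm of the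
  dual. Evaluated at \<open>x\<close>, its tail is a series in the field, where the strong triangle inequality
  bounds it by the largest term, which is at most
  \<open>\<parallel>b\<parallel> \<parallel>x\<parallel> sup {\<parallel>a\<^sub>n\<parallel> \<parallel>y\<^sub>n\<parallel> | n \<ge> N}\<close>. Hence
  \<open>\<parallel>a\<^sub>n\<parallel> \<parallel>y\<^sub>n\<parallel> \<longlonglongrightarrow> 0\<close> suffices, and this follows from \<open>r\<close>-summability for every finite \<open>r\<close>
  (with an Archimedean absolute value one would need \<open>\<parallel>a\<^sub>n\<parallel> \<parallel>y\<^sub>n\<parallel>\<close> to be summable). The key lemmas are
  \<open>adjoint_tail_bound\<close> and \<open>nuclear_rep_adjoint\<close>. For \<open>r = \<infinity>\<close> the claim is the usual
  \<open>\<parallel>T\<^sup>*\<parallel> \<le> \<parallel>T\<parallel>\<close>.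

  All of this uses that continuous functionals are bounded, so that the dual is a normed space. That
  is where nontriviality of the valuation enters: it supplies the scalars needed to rescale a
  vector into a given ball.
\<close>

section \<open>Valuations\<close>

context nonarch_valued_field
begin

lemma val_0 [simp]: "v 0 = 0"
  by (simp add: val_eq_0_iff)

lemma val_1 [simp]: "v 1 = 1"
  using val_mult[of 1 1] val_eq_0_iff[of 1] by simp

lemma val_minus [simp]: "v (- a) = v a"
proof -
  have "v (-1) * v (-1) = 1"
    using val_mult[of "-1" "-1"] by simp
  then have "v (-1) = 1"
    using val_nonneg[of "-1"] by (metis abs_of_nonneg abs_mult_self_eq power2_eq_1_iff
        power2_eq_square abs_1 abs_minus_cancel)
  then show ?thesis
    using val_mult[of "-1" a] by simp
qed

lemma val_add_le: "v (a + b) \<le> v a + v b"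
  using val_ultra[of a b] val_nonneg[of a] val_nonneg[of b] by linarith

lemma val_inverse: "v (inverse a) = inverse (v a)"
proof (cases "a = 0")
  case False
  then have "v a * v (inverse a) = 1"
    using val_mult[of a "inverse a"] by simp
  then show ?thesis
    by (metis inverse_unique)
qed simp

lemma val_power: "v (a ^ n) = v a ^ n"
  by (induction n) (auto simp: val_mult)

lemma val_power_int: "v (a powi k) = v a powi k"
  by (auto simp: power_int_def val_power val_inverse)

lemma val_sum_le:
  assumes "0 \<le> K" and "\<And>n. n \<in> S \<Longrightarrow> v (f n) \<le> K"
  shows "v (\<Sum>n\<in>S. f n) \<le> K"
  using assms(2)
proof (induction S rule: infinite_finite_induct)
  case (insert n S)
  then show ?case
    using val_ultra[of "f n" "sum f S"] by (simp add: order_trans)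
qed (use assms(1) in auto)

lemma val_gt_1_exists:
  assumes "nontrivial_valuation v"
  obtains a where "1 < v a"
proof -
  obtain a where a: "a \<noteq> 0" "v a \<noteq> 1"
    using assms by (auto simp: nontrivial_valuation_def)
  show thesis
  proof (cases "1 < v a")
    case False
    then have "0 < v a" "v a < 1"
      using a val_nonneg[of a] val_eq_0_iff[of a] by auto
    then show thesis
      using that[of "inverse a"] by (simp add: val_inverse one_less_inverse)
  qed (use that in blast)
qed

text \<open>The substitute for normalising a vector: the value group need not contain \<open>t\<close>, but
  among the powers of a single value \<open>s > 1\<close> one lies below \<open>t\<close> by at most a factor \<open>s\<close>.\<close>

lemma val_approximates:
  assumes "1 < v a" and "0 < t"
  obtains c where "v c < t" and "t \<le> v c * v a"
proof -
  define k where "k = \<lceil>log (v a) t\<rceil> - 1"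
  have k: "real_of_int k < log (v a) t" "log (v a) t \<le> real_of_int k + 1"
    unfolding k_def by linarith+
  have powi: "v (a powi k) = v a powr real_of_int k"
    using assms(1) by (simp add: val_power_int powr_real_of_int')
  have "v a powr real_of_int k < t"
    using k(1) assms by (simp add: less_log_iff)
  moreover have "t \<le> v a powr real_of_int k * v a"
    using k(2) assms by (simp add: log_le_iff powr_add)
  ultimately show thesis
    using that[of "a powi k"] powi by simp
qed

end

section \<open>Normed spaces and operator norms\<close>

lemma base_space_sel [simp]:
  "vecs (base_space v) = UNIV" "smul (base_space v) = (*)" "nrm (base_space v) = v"
  by (simp_all add: base_space_def)

lemma dual_sel [simp]:
  "smul (dual v E) = (\<lambda>c f x. c * f x)" "nrm (dual v E) = opnorm E (base_space v)"
  by (simp_all add: dual_def)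

lemma normed_spaceD:
  assumes "normed_space v E"
  shows normed_space_vector_space: "vector_space (smul E)"
    and normed_space_subspace: "module.subspace (smul E) (vecs E)"
    and nrm_nonneg: "\<And>x. x \<in> vecs E \<Longrightarrow> 0 \<le> nrm E x"
    and nrm_eq_0_iff: "\<And>x. x \<in> vecs E \<Longrightarrow> nrm E x = 0 \<longleftrightarrow> x = 0"
    and nrm_smul: "\<And>c x. x \<in> vecs E \<Longrightarrow> nrm E (smul E c x) = v c * nrm E x"
    and nrm_triangle: "\<And>x y. x \<in> vecs E \<Longrightarrow> y \<in> vecs E \<Longrightarrow> nrm E (x + y) \<le> nrm E x + nrm E y"
  using assms by (auto simp: normed_space_def)

lemma vecs_closed:
  assumes "normed_space v E"
  shows vecs_0: "0 \<in> vecs E"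
    and vecs_add: "\<And>x y. x \<in> vecs E \<Longrightarrow> y \<in> vecs E \<Longrightarrow> x + y \<in> vecs E"
    and vecs_diff: "\<And>x y. x \<in> vecs E \<Longrightarrow> y \<in> vecs E \<Longrightarrow> x - y \<in> vecs E"
    and vecs_smul: "\<And>c x. x \<in> vecs E \<Longrightarrow> smul E c x \<in> vecs E"
    and vecs_sum: "\<And>f S. (\<And>n. n \<in> S \<Longrightarrow> f n \<in> vecs E) \<Longrightarrow> sum f S \<in> vecs E"
proof -
  interpret vector_space "smul E"
    by (rule normed_space_vector_space[OF assms])
  note sub = normed_space_subspace[OF assms]
  show "0 \<in> vecs E"
    and "\<And>x y. x \<in> vecs E \<Longrightarrow> y \<in> vecs E \<Longrightarrow> x + y \<in> vecs E"
    and "\<And>x y. x \<in> vecs E \<Longrightarrow> y \<in> vecs E \<Longrightarrow> x - y \<in> vecs E"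
    and "\<And>c x. x \<in> vecs E \<Longrightarrow> smul E c x \<in> vecs E"
    and "\<And>f S. (\<And>n. n \<in> S \<Longrightarrow> f n \<in> vecs E) \<Longrightarrow> sum f S \<in> vecs E"
    using sub by (auto intro: subspace_0 subspace_add subspace_diff subspace_scale subspace_sum)
qed

lemma linear_maps_add:
  "A \<in> linear_maps E H \<Longrightarrow> x \<in> vecs E \<Longrightarrow> y \<in> vecs E \<Longrightarrow> A (x + y) = A x + A y"
  by (simp add: linear_maps_def)

lemma linear_maps_smul:
  "A \<in> linear_maps E H \<Longrightarrow> x \<in> vecs E \<Longrightarrow> A (smul E c x) = smul H c (A x)"
  by (simp add: linear_maps_def)

lemma linear_maps_0:
  assumes "normed_space v E" and "A \<in> linear_maps E H"
  shows "A 0 = 0"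
  using linear_maps_add[OF assms(2), of 0 0] vecs_0[OF assms(1)] by simp

lemma linear_maps_diff:
  assumes "normed_space v E" and "A \<in> linear_maps E H" and "x \<in> vecs E" and "y \<in> vecs E"
  shows "A (x - y) = A x - A y"
  using linear_maps_add[OF assms(2) vecs_diff[OF assms(1,3,4)] assms(4)] by (simp add: algebra_simps)

lemma linear_maps_sum:
  assumes "normed_space v E" and "A \<in> linear_maps E H" and "\<And>n. n \<in> S \<Longrightarrow> x n \<in> vecs E"
  shows "A (sum x S) = (\<Sum>n\<in>S. A (x n))"
  using assms(3)
proof (induction S rule: infinite_finite_induct)
  case (insert n S)
  then show ?case
    using linear_maps_add[OF assms(2), of "x n" "sum x S"] vecs_sum[OF assms(1), of S x] by simp
qed (use linear_maps_0[OF assms(1,2)] in auto)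

lemma opnorm_le:
  assumes "normed_space v E" and "0 \<le> C" and "\<And>x. x \<in> vecs E \<Longrightarrow> nrm H (A x) \<le> C * nrm E x"
  shows "opnorm E H A \<le> C"
  unfolding opnorm_def
proof (rule cSUP_least)
  show "vecs E \<noteq> {}"
    using vecs_0[OF assms(1)] by blast
  fix x assume x: "x \<in> vecs E"
  show "nrm H (A x) / nrm E x \<le> C"
    using assms(3)[OF x] nrm_nonneg[OF assms(1) x] assms(2)
    by (cases "nrm E x = 0") (auto simp: divide_le_eq)
qed

lemma bdd_above_opnorm:
  assumes "normed_space v E" and "\<And>x. x \<in> vecs E \<Longrightarrow> nrm H (A x) \<le> C * nrm E x"
  shows "bdd_above ((\<lambda>x. nrm H (A x) / nrm E x) ` vecs E)"
proof (rule bdd_aboveI2)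
  fix x assume x: "x \<in> vecs E"
  show "nrm H (A x) / nrm E x \<le> \<bar>C\<bar>"
    using assms(2)[OF x] nrm_nonneg[OF assms(1) x]
    by (cases "nrm E x = 0") (auto simp: divide_le_eq intro: order_trans mult_right_mono)
qed

lemma opnorm_bound:
  assumes "normed_space v E" and "\<And>x. x \<in> vecs E \<Longrightarrow> nrm H (A x) \<le> C * nrm E x" and x: "x \<in> vecs E"
  shows "nrm H (A x) \<le> opnorm E H A * nrm E x"
proof (cases "nrm E x = 0")
  case True
  then show ?thesis
    using assms(2)[OF x] by simp
next
  case False
  then have "0 < nrm E x"
    using nrm_nonneg[OF assms(1) x] by simp
  moreover have "nrm H (A x) / nrm E x \<le> opnorm E H A"
    unfolding opnorm_def by (rule cSUP_upper[OF x bdd_above_opnorm[OF assms(1,2)]])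
  ultimately show ?thesis
    by (simp add: divide_le_eq)
qed

lemma opnorm_nonneg:
  assumes "normed_space v E" and "\<And>x. x \<in> vecs E \<Longrightarrow> nrm H (A x) \<le> C * nrm E x"
  shows "0 \<le> opnorm E H A"
proof -
  have "nrm H (A 0) / nrm E 0 \<le> opnorm E H A"
    unfolding opnorm_def
    by (rule cSUP_upper[OF vecs_0[OF assms(1)] bdd_above_opnorm[OF assms]])
  then show ?thesis
    using nrm_eq_0_iff[OF assms(1) vecs_0[OF assms(1)]] by simp
qed

lemma bounded_ops_opnorm:
  assumes "normed_space v E" and "A \<in> bounded_ops E H"
  shows bounded_ops_bound: "\<And>x. x \<in> vecs E \<Longrightarrow> nrm H (A x) \<le> opnorm E H A * nrm E x"
    and bounded_ops_nonneg: "0 \<le> opnorm E H A"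
proof -
  obtain C where "\<And>x. x \<in> vecs E \<Longrightarrow> nrm H (A x) \<le> C * nrm E x"
    using assms(2) by (auto simp: bounded_ops_def)
  then show "\<And>x. x \<in> vecs E \<Longrightarrow> nrm H (A x) \<le> opnorm E H A * nrm E x" "0 \<le> opnorm E H A"
    using opnorm_bound opnorm_nonneg assms(1) by blast+
qed

section \<open>The dual space\<close>

context nonarch_valued_field
begin

text \<open>Continuity at 0 bounds \<open>f\<close> by 1 on a ball of radius \<open>\<delta>\<close>. Every nonzero vector can be scaled
  into that ball so that its norm stays at least \<open>\<delta>\<close> divided by a fixed value greater than 1, and
  homogeneity then bounds \<open>f\<close> everywhere.\<close>

lemma continuous_functional_bounded:
  assumes E: "normed_space v E" and nontriv: "nontrivial_valuation v"
    and f: "f \<in> linear_maps E (base_space v)" and cont: "continuous_map_between E (base_space v) f"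
  shows "\<exists>C. \<forall>x\<in>vecs E. v (f x) \<le> C * nrm E x"
proof -
  note f0 = linear_maps_0[OF E f]
  have "\<exists>\<delta>>0. \<forall>y\<in>vecs E. nrm E (y - 0) < \<delta> \<longrightarrow> v (f y - f 0) < 1"
    using cont vecs_0[OF E] unfolding continuous_map_between_def base_space_sel
    by (metis zero_less_one)
  then obtain \<delta> where \<delta>: "0 < \<delta>" "\<And>y. y \<in> vecs E \<Longrightarrow> nrm E y < \<delta> \<Longrightarrow> v (f y) < 1"
    using f0 by auto
  obtain a where a: "1 < v a"
    using val_gt_1_exists[OF nontriv] .
  have "v (f x) \<le> (v a / \<delta>) * nrm E x" if x: "x \<in> vecs E" for x
  proof (cases "x = 0")
    case True
    then show ?thesis
      using f0 nrm_eq_0_iff[OF E x] by simp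
  next
    case False
    then have pos: "0 < nrm E x"
      using nrm_eq_0_iff[OF E x] nrm_nonneg[OF E x] by simp
    obtain c where c: "v c < \<delta> / nrm E x" "\<delta> / nrm E x \<le> v c * v a"
      using val_approximates[OF a, of "\<delta> / nrm E x"] \<delta>(1) pos by auto
    have "nrm E (smul E c x) < \<delta>"
      using c(1) pos by (simp add: nrm_smul[OF E x] less_divide_eq)
    then have "v c * v (f x) < 1"
      using \<delta>(2)[OF vecs_smul[OF E x]] linear_maps_smul[OF f x] by (simp add: val_mult)
    then have "v a * (v c * v (f x)) \<le> v a"
      using a by simp
    moreover have "\<delta> / nrm E x * v (f x) \<le> v c * v a * v (f x)"
      by (rule mult_right_mono[OF c(2) val_nonneg])
    ultimately have "\<delta> / nrm E x * v (f x) \<le> v a"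
      by (simp add: mult_ac)
    then show ?thesis
      using \<delta>(1) pos by (simp add: field_simps)
  qed
  then show ?thesis
    by blast
qed

lemma bounded_functional_continuous:
  assumes E: "normed_space v E" and f: "f \<in> bounded_ops E (base_space v)"
  shows "continuous_map_between E (base_space v) f"
  unfolding continuous_map_between_def base_space_sel
proof (intro ballI allI impI)
  fix x \<epsilon> assume x: "x \<in> vecs E" and \<epsilon>: "(0::real) < \<epsilon>"
  have flin: "f \<in> linear_maps E (base_space v)"
    using f by (simp add: bounded_ops_def)
  \<comment> \<open>The norm of \<open>f\<close> may be 0; adding 1 makes \<open>\<epsilon> / C\<close> a legitimate radius.\<close>
  define C where "C = opnorm E (base_space v) f + 1"
  have C: "0 < C" "\<And>y. y \<in> vecs E \<Longrightarrow> v (f y) \<le> C * nrm E y"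
    using bounded_ops_nonneg[OF E f] bounded_ops_bound[OF E f] nrm_nonneg[OF E]
    by (fastforce simp: C_def algebra_simps)+
  have "v (f y - f x) < \<epsilon>" if y: "y \<in> vecs E" "nrm E (y - x) < \<epsilon> / C" for y
  proof -
    have "f y - f x = f (y - x)"
      using linear_maps_diff[OF E flin y(1) x] by simp
    then have "v (f y - f x) \<le> C * nrm E (y - x)"
      using C(2)[OF vecs_diff[OF E y(1) x]] by simp
    also have "\<dots> < \<epsilon>"
      using y(2) C(1) by (simp add: field_simps)
    finally show ?thesis .
  qed
  then show "\<exists>\<delta>>0. \<forall>y\<in>vecs E. nrm E (y - x) < \<delta> \<longrightarrow> v (f y - f x) < \<epsilon>"
    using \<epsilon> C(1) by (intro exI[of _ "\<epsilon> / C"]) auto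
qed

lemma vecs_dual:
  assumes "normed_space v E" and "nontrivial_valuation v"
  shows "vecs (dual v E) = bounded_ops E (base_space v)"
  using continuous_functional_bounded[OF assms] bounded_functional_continuous[OF assms(1)]
  by (auto simp: dual_def bounded_ops_def)

lemma bounded_functional_add:
  assumes E: "normed_space v E"
    and f: "f \<in> bounded_ops E (base_space v)" and g: "g \<in> bounded_ops E (base_space v)"
  shows "f + g \<in> bounded_ops E (base_space v)"
    and "opnorm E (base_space v) (f + g) \<le> opnorm E (base_space v) f + opnorm E (base_space v) g"
proof -
  let ?C = "opnorm E (base_space v) f + opnorm E (base_space v) g"
  have bound: "v ((f + g) x) \<le> ?C * nrm E x" if x: "x \<in> vecs E" for x
    using bounded_ops_bound[OF E f x] bounded_ops_bound[OF E g x] val_add_le[of "f x" "g x"]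
    by (simp add: algebra_simps)
  have "f + g \<in> linear_maps E (base_space v)"
    using f g by (auto simp: bounded_ops_def linear_maps_def algebra_simps)
  then show "f + g \<in> bounded_ops E (base_space v)"
    using bound unfolding bounded_ops_def base_space_sel by blast
  show "opnorm E (base_space v) (f + g) \<le> ?C"
    using bounded_ops_nonneg[OF E f] bounded_ops_nonneg[OF E g] bound
    by (intro opnorm_le[OF E]) auto
qed

lemma bounded_functional_smul:
  assumes E: "normed_space v E" and f: "f \<in> bounded_ops E (base_space v)"
  shows "(\<lambda>x. c * f x) \<in> bounded_ops E (base_space v)"
    and "opnorm E (base_space v) (\<lambda>x. c * f x) \<le> v c * opnorm E (base_space v) f"
proof -
  have bound: "v (c * f x) \<le> (v c * opnorm E (base_space v) f) * nrm E x" if x: "x \<in> vecs E" for x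
    using mult_left_mono[OF bounded_ops_bound[OF E f x] val_nonneg[of c]]
    by (simp add: val_mult mult_ac)
  have "(\<lambda>x. c * f x) \<in> linear_maps E (base_space v)"
    using f by (auto simp: bounded_ops_def linear_maps_def algebra_simps)
  then show "(\<lambda>x. c * f x) \<in> bounded_ops E (base_space v)"
    using bound unfolding bounded_ops_def base_space_sel by blast
  show "opnorm E (base_space v) (\<lambda>x. c * f x) \<le> v c * opnorm E (base_space v) f"
    using bounded_ops_nonneg[OF E f] bound val_nonneg
    by (intro opnorm_le[OF E]) auto
qed

lemma opnorm_functional_smul:
  assumes E: "normed_space v E" and f: "f \<in> bounded_ops E (base_space v)"
  shows "opnorm E (base_space v) (\<lambda>x. c * f x) = v c * opnorm E (base_space v) f"
proof (rule antisym[OF bounded_functional_smul(2)[OF E f]])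
  note cf = bounded_functional_smul(1)[OF E f, of c]
  show "v c * opnorm E (base_space v) f \<le> opnorm E (base_space v) (\<lambda>x. c * f x)"
  proof (cases "c = 0")
    case True
    then show ?thesis
      using bounded_ops_nonneg[OF E cf] by simp
  next
    case False
    then have "0 < v c"
      using val_eq_0_iff[of c] val_nonneg[of c] by simp
    \<comment> \<open>The inequality already known, applied to the scalar \<open>inverse c\<close> and the functional \<open>c f\<close>.\<close>
    moreover have "(\<lambda>x. inverse c * (c * f x)) = f"
      using False by (simp add: mult.assoc[symmetric])
    then have "opnorm E (base_space v) f \<le> inverse (v c) * opnorm E (base_space v) (\<lambda>x. c * f x)"
      using bounded_functional_smul(2)[OF E cf, of "inverse c"] by (simp add: val_inverse)
    ultimately show ?thesis
      by (simp add: field_simps)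
  qed
qed

theorem normed_space_dual:
  fixes E :: "('f, 'e::ab_group_add) nspace"
  assumes E: "normed_space v E" and nontriv: "nontrivial_valuation v"
  shows "normed_space v (dual v E)"
proof -
  note vd = vecs_dual[OF E nontriv]
  have vs: "vector_space (\<lambda>c (f :: 'e \<Rightarrow> 'f) x. c * f x)"
    by unfold_locales (auto simp: fun_eq_iff algebra_simps)
  have zero: "0 \<in> bounded_ops E (base_space v)"
    by (auto simp: bounded_ops_def linear_maps_def intro!: exI[of _ 0])
  have sub: "module.subspace (\<lambda>c (f :: 'e \<Rightarrow> 'f) x. c * f x) (bounded_ops E (base_space v))"
    using vs bounded_functional_add(1)[OF E] bounded_functional_smul(1)[OF E] zero
    by (simp add: module.subspace_def module_iff_vector_space)
  have "f = 0" if f: "f \<in> bounded_ops E (base_space v)" "opnorm E (base_space v) f = 0" for f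
  proof
    fix x show "f x = 0 x"
    proof (cases "x \<in> vecs E")
      case True
      then have "v (f x) = 0"
        using bounded_ops_bound[OF E f(1) True] f(2) val_nonneg[of "f x"] by simp
      then show ?thesis
        by (simp add: val_eq_0_iff)
    next
      case False
      then show ?thesis
        using f(1) by (auto simp: bounded_ops_def linear_maps_def)
    qed
  qed
  moreover have "opnorm E (base_space v) 0 = 0"
    using opnorm_functional_smul[OF E zero, of 0] by (simp add: zero_fun_def)
  ultimately show ?thesis
    unfolding normed_space_def vd dual_sel
    using vs sub bounded_ops_nonneg[OF E] opnorm_functional_smul[OF E]
      bounded_functional_add(2)[OF E]
    by blast
qed

section \<open>Evaluations and the adjoint\<close>

text \<open>Membership in the dual of a dual forces the value 0 outside the dual.\<close>

definition evaluation :: "('f, 'w::ab_group_add) nspace \<Rightarrow> 'w \<Rightarrow> ('w \<Rightarrow> 'f) \<Rightarrow> 'f" where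
  "evaluation H y = (\<lambda>b. if b \<in> vecs (dual v H) then b y else 0)"

lemma evaluation_dual_dual:
  assumes H: "normed_space v H" and nontriv: "nontrivial_valuation v" and y: "y \<in> vecs H"
  shows evaluation_in_bidual: "evaluation H y \<in> vecs (dual v (dual v H))"
    and evaluation_norm_le: "nrm (dual v (dual v H)) (evaluation H y) \<le> nrm H y"
proof -
  note DH = normed_space_dual[OF H nontriv]
  note vd = vecs_dual[OF H nontriv]
  have lin: "evaluation H y \<in> linear_maps (dual v H) (base_space v)"
    using vecs_add[OF DH] vecs_smul[OF DH] unfolding linear_maps_def
    by (auto simp: evaluation_def)
  have bound: "v (evaluation H y b) \<le> nrm H y * nrm (dual v H) b" if "b \<in> vecs (dual v H)" for b
    using bounded_ops_bound[OF H _ y, of b "base_space v"] that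
    by (simp add: evaluation_def vd mult_ac)
  show "evaluation H y \<in> vecs (dual v (dual v H))"
    using lin bound unfolding vecs_dual[OF DH nontriv] bounded_ops_def base_space_sel by blast
  show "nrm (dual v (dual v H)) (evaluation H y) \<le> nrm H y"
    unfolding dual_sel(2)[of v "dual v H"]
    using bound nrm_nonneg[OF H y] by (intro opnorm_le[OF DH]) auto
qed

lemma adjoint_bounded:
  assumes E: "normed_space v E" and H: "normed_space v H" and nontriv: "nontrivial_valuation v"
    and T: "T \<in> bounded_ops E H"
  shows adjoint_in_bounded_ops: "adjoint v H T \<in> bounded_ops (dual v H) (dual v E)"
    and adjoint_opnorm_le: "opnorm (dual v H) (dual v E) (adjoint v H T) \<le> opnorm E H T"
proof -
  note DH = normed_space_dual[OF H nontriv]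
  note vdH = vecs_dual[OF H nontriv] and vdE = vecs_dual[OF E nontriv]
  have Tlin: "T \<in> linear_maps E H"
    using T by (simp add: bounded_ops_def)
  have bound: "v (b (T x)) \<le> (opnorm E H T * nrm (dual v H) b) * nrm E x"
    if b: "b \<in> vecs (dual v H)" and x: "x \<in> vecs E" for b x
  proof -
    have "v (b (T x)) \<le> nrm (dual v H) b * nrm H (T x)"
      using bounded_ops_bound[OF H, of b "base_space v" "T x"] b x Tlin
      by (simp add: vdH linear_maps_def)
    also have "\<dots> \<le> nrm (dual v H) b * (opnorm E H T * nrm E x)"
      by (intro mult_left_mono bounded_ops_bound[OF E T x] nrm_nonneg[OF DH b])
    finally show ?thesis
      by (simp add: mult_ac)
  qed
  have mem: "(\<lambda>x. b (T x)) \<in> vecs (dual v E)" if b: "b \<in> vecs (dual v H)" for b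
  proof -
    have blin: "b \<in> linear_maps H (base_space v)"
      using b by (simp add: vdH bounded_ops_def)
    have "(\<lambda>x. b (T x)) \<in> linear_maps E (base_space v)"
      using blin Tlin linear_maps_0[OF H blin] by (simp add: linear_maps_def)
    then show ?thesis
      using bound[OF b] unfolding vdE bounded_ops_def base_space_sel by blast
  qed
  have lin: "adjoint v H T \<in> linear_maps (dual v H) (dual v E)"
    using mem vecs_add[OF DH] vecs_smul[OF DH] unfolding linear_maps_def
    by (auto simp: adjoint_def fun_eq_iff)
  have nbound: "nrm (dual v E) (adjoint v H T b) \<le> opnorm E H T * nrm (dual v H) b"
    if b: "b \<in> vecs (dual v H)" for b
    unfolding dual_sel(2)[of v E]
    using bound[OF b] b bounded_ops_nonneg[OF E T] nrm_nonneg[OF DH b]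
    by (intro opnorm_le[OF E]) (auto simp: adjoint_def)
  show "adjoint v H T \<in> bounded_ops (dual v H) (dual v E)"
    using lin nbound unfolding bounded_ops_def by blast
  show "opnorm (dual v H) (dual v E) (adjoint v H T) \<le> opnorm E H T"
    using nbound bounded_ops_nonneg[OF E T] by (intro opnorm_le[OF DH]) auto
qed

section \<open>The transposed nuclear representation\<close>

text \<open>The remainder after \<open>N\<close> terms splits, for any \<open>M \<ge> N\<close>, into the image under \<open>b\<close> of the
  remainder after \<open>M\<close> terms of the series for \<open>T x\<close> and the finite block of terms from \<open>N\<close> to
  \<open>M\<close>. The strong triangle inequality bounds the block independently of its length, and the
  remainder after \<open>M\<close> terms vanishes in the limit.\<close>

lemma adjoint_tail_bound:
  assumes E: "normed_space v E" and H: "normed_space v H" and nontriv: "nontrivial_valuation v"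
    and x: "x \<in> vecs E" and Tx: "Tx \<in> vecs H" and b: "b \<in> vecs (dual v H)"
    and a: "\<And>n. a n \<in> vecs (dual v E)" and y: "\<And>n. y n \<in> vecs H"
    and lim: "(\<lambda>M. nrm H (Tx - (\<Sum>n<M. smul H (a n x) (y n)))) \<longlonglongrightarrow> 0"
    and K: "\<And>n. N \<le> n \<Longrightarrow> nrm (dual v E) (a n) * nrm H (y n) \<le> K"
  shows "v (b Tx - (\<Sum>n<N. b (y n) * a n x)) \<le> K * nrm (dual v H) b * nrm E x"
proof -
  note vdH = vecs_dual[OF H nontriv] and vdE = vecs_dual[OF E nontriv]
  define B where "B = nrm (dual v H) b"
  have bop: "b \<in> bounded_ops H (base_space v)"
    using b by (simp add: vdH)
  then have blin: "b \<in> linear_maps H (base_space v)"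
    by (simp add: bounded_ops_def)
  have B: "0 \<le> B" "\<And>z. z \<in> vecs H \<Longrightarrow> v (b z) \<le> B * nrm H z"
    using bounded_ops_nonneg[OF H bop] bounded_ops_bound[OF H bop] by (auto simp: B_def)
  have x0: "0 \<le> nrm E x"
    by (rule nrm_nonneg[OF E x])
  have term_le: "v (b (y n) * a n x) \<le> K * B * nrm E x" if "N \<le> n" for n
  proof -
    have aop: "a n \<in> bounded_ops E (base_space v)"
      using a vdE by auto
    have "v (b (y n)) * v (a n x) \<le> (B * nrm H (y n)) * (nrm (dual v E) (a n) * nrm E x)"
      using B(2)[OF y] bounded_ops_bound[OF E aop x] B(1) nrm_nonneg[OF H y] val_nonneg
      by (intro mult_mono) auto
    also have "\<dots> = nrm (dual v E) (a n) * nrm H (y n) * (B * nrm E x)"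
      by (simp add: mult_ac)
    also have "\<dots> \<le> K * (B * nrm E x)"
      by (intro mult_right_mono K that mult_nonneg_nonneg B(1) x0)
    finally show ?thesis
      by (simp add: val_mult mult_ac)
  qed
  have K0: "0 \<le> K * B * nrm E x"
    using term_le[of N] val_nonneg order_trans by blast
  define R where "R M = Tx - (\<Sum>n<M. smul H (a n x) (y n))" for M
  have sm: "(\<Sum>n<M. smul H (a n x) (y n)) \<in> vecs H" for M
    by (intro vecs_sum[OF H] vecs_smul[OF H] y)
  have R: "R M \<in> vecs H" for M
    unfolding R_def by (rule vecs_diff[OF H Tx sm])
  have bR: "b (R M) = b Tx - (\<Sum>n<M. b (y n) * a n x)" for M
  proof -
    have "b (\<Sum>n<M. smul H (a n x) (y n)) = (\<Sum>n<M. b (smul H (a n x) (y n)))"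
      by (intro linear_maps_sum[OF H blin] vecs_smul[OF H] y)
    then show ?thesis
      using linear_maps_diff[OF H blin Tx sm] linear_maps_smul[OF blin y]
      by (simp add: R_def mult.commute)
  qed
  have le: "v (b (R N)) \<le> max (B * nrm H (R M)) (K * B * nrm E x)" if "N \<le> M" for M
  proof -
    have "(\<Sum>n<M. b (y n) * a n x) = (\<Sum>n<N. b (y n) * a n x) + (\<Sum>n=N..<M. b (y n) * a n x)"
      using sum.atLeastLessThan_concat[of 0 N M "\<lambda>n. b (y n) * a n x"] that
      by (simp add: atLeast0LessThan)
    then have "b (R N) = b (R M) + (\<Sum>n=N..<M. b (y n) * a n x)"
      by (simp add: bR)
    then have "v (b (R N)) \<le> max (v (b (R M))) (v (\<Sum>n=N..<M. b (y n) * a n x))"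
      using val_ultra by simp
    also have "\<dots> \<le> max (B * nrm H (R M)) (K * B * nrm E x)"
      by (intro max.mono B(2) R val_sum_le K0 term_le) simp
    finally show ?thesis .
  qed
  have "(\<lambda>M. max (B * nrm H (R M)) (K * B * nrm E x)) \<longlonglongrightarrow> max (B * 0) (K * B * nrm E x)"
    using lim unfolding R_def by (intro tendsto_intros)
  then have "v (b (R N)) \<le> max (B * 0) (K * B * nrm E x)"
    by (rule LIMSEQ_le_const) (use le in blast)
  then show ?thesis
    using K0 by (simp add: bR B_def)
qed

lemma nuclear_rep_products_vanish:
  assumes "nuclear_rep v E H p A a y" and E: "normed_space v E" and H: "normed_space v H"
    and nontriv: "nontrivial_valuation v" and p: "0 < p"
  shows "(\<lambda>n. nrm (dual v E) (a n) * nrm H (y n)) \<longlonglongrightarrow> 0"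
proof -
  let ?t = "\<lambda>n. nrm (dual v E) (a n) * nrm H (y n)"
  have nonneg: "0 \<le> nrm (dual v E) (a n)" "0 \<le> nrm H (y n)" for n
    using assms(1) nrm_nonneg[OF normed_space_dual[OF E nontriv]] nrm_nonneg[OF H]
    by (auto simp: nuclear_rep_def simp del: dual_sel)
  have "summable (\<lambda>n. ?t n powr p)"
    using assms(1) nonneg by (simp add: nuclear_rep_def powr_mult)
  then have "(\<lambda>n. ?t n powr p) \<longlonglongrightarrow> 0"
    by (rule summable_LIMSEQ_zero)
  then have "(\<lambda>n. (?t n powr p) powr (1 / p)) \<longlonglongrightarrow> 0 powr (1 / p)"
    by (rule tendsto_powr'[OF _ tendsto_const]) (use p in auto)
  then show ?thesis
    using p nonneg by (simp add: powr_powr)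
qed

text \<open>The vectors and functionals change places, and each \<open>y\<^sub>n\<close> enters through its image in the
  bidual, which has no larger norm.\<close>

lemma nuclear_rep_adjoint:
  assumes E: "normed_space v E" and H: "normed_space v H" and nontriv: "nontrivial_valuation v"
    and T: "T \<in> bounded_ops E H" and p: "0 < p" and rep: "nuclear_rep v E H p T a y"
  shows nuclear_rep_transpose:
      "nuclear_rep v (dual v H) (dual v E) p (adjoint v H T) (\<lambda>n. evaluation H (y n)) a"
    and nuclear_rep_transpose_sum_le:
      "(\<Sum>n. nrm (dual v (dual v H)) (evaluation H (y n)) powr p * nrm (dual v E) (a n) powr p)
        \<le> (\<Sum>n. nrm (dual v E) (a n) powr p * nrm H (y n) powr p)"
proof -
  note DH = normed_space_dual[OF H nontriv]
  note DDH = normed_space_dual[OF DH nontriv]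
  note DE = normed_space_dual[OF E nontriv]
  let ?w = "\<lambda>n. nrm (dual v (dual v H)) (evaluation H (y n)) powr p * nrm (dual v E) (a n) powr p"
  let ?u = "\<lambda>n. nrm (dual v E) (a n) powr p * nrm H (y n) powr p"
  have a: "\<And>n. a n \<in> vecs (dual v E)" and y: "\<And>n. y n \<in> vecs H"
    and lim: "\<And>x. x \<in> vecs E \<Longrightarrow> (\<lambda>N. nrm H (T x - (\<Sum>n<N. smul H (a n x) (y n)))) \<longlonglongrightarrow> 0"
    and summ: "summable ?u"
    using rep by (auto simp: nuclear_rep_def)
  have ev: "evaluation H (y n) \<in> vecs (dual v (dual v H))" for n
    by (rule evaluation_in_bidual[OF H nontriv y])
  have wu: "0 \<le> ?w n" "?w n \<le> ?u n" for n
  proof -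
    have "nrm (dual v (dual v H)) (evaluation H (y n)) powr p \<le> nrm H (y n) powr p"
      using p by (intro powr_mono2 evaluation_norm_le[OF H nontriv y] nrm_nonneg[OF DDH ev]) simp
    then show "?w n \<le> ?u n"
      by (metis mult.commute mult_right_mono powr_ge_zero)
  qed simp
  have summw: "summable ?w"
    by (rule summable_comparison_test'[OF summ]) (use wu in simp)
  show "(\<Sum>n. ?w n) \<le> (\<Sum>n. ?u n)"
    by (rule suminf_le[OF wu(2) summw summ])
  have conv: "(\<lambda>N. nrm (dual v E) (adjoint v H T b
      - (\<Sum>n<N. smul (dual v E) (evaluation H (y n) b) (a n)))) \<longlonglongrightarrow> 0"
    if b: "b \<in> vecs (dual v H)" for b
  proof (rule LIMSEQ_I)
    fix \<epsilon> :: real assume \<epsilon>: "0 < \<epsilon>"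
    define B where "B = nrm (dual v H) b"
    have B: "0 \<le> B"
      unfolding B_def by (rule nrm_nonneg[OF DH b])
    \<comment> \<open>\<open>K\<close> must be positive with \<open>K * B < \<epsilon>\<close> even when \<open>B = 0\<close>.\<close>
    define K where "K = \<epsilon> / (2 * (B + 1))"
    have K: "0 < K" "K * B < \<epsilon>"
    proof -
      show "0 < K"
        using \<epsilon> B by (simp add: K_def)
      then have "K * B \<le> K * (B + 1)"
        by simp
      also have "\<dots> = \<epsilon> / 2"
        using B by (simp add: K_def field_simps)
      finally show "K * B < \<epsilon>"
        using \<epsilon> by simp
    qed
    obtain N0 where N0: "nrm (dual v E) (a n) * nrm H (y n) \<le> K" if "N0 \<le> n" for n
      using order_tendstoD(2)[OF nuclear_rep_products_vanish[OF rep E H nontriv p] K(1)]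
      unfolding eventually_sequentially by (meson less_imp_le)
    have "norm (nrm (dual v E) (adjoint v H T b
      - (\<Sum>n<N. smul (dual v E) (evaluation H (y n) b) (a n))) - 0) < \<epsilon>" if N: "N0 \<le> N" for N
    proof -
      let ?R = "adjoint v H T b - (\<Sum>n<N. smul (dual v E) (evaluation H (y n) b) (a n))"
      have "(\<Sum>n<N. smul (dual v E) (evaluation H (y n) b) (a n)) x = (\<Sum>n<N. b (y n) * a n x)" for x
        by (induction N) (use b in \<open>simp_all add: evaluation_def\<close>)
      then have R: "?R x = b (T x) - (\<Sum>n<N. b (y n) * a n x)" for x
        using b by (simp add: adjoint_def)
      have "v (?R x) \<le> (K * B) * nrm E x" if x: "x \<in> vecs E" for x
        unfolding R B_def
        using T x N0 N
        by (intro adjoint_tail_bound[OF E H nontriv x _ b a y lim[OF x]])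
          (auto simp: bounded_ops_def linear_maps_def)
      then have "opnorm E (base_space v) ?R \<le> K * B"
        using K B by (intro opnorm_le[OF E]) auto
      moreover have "?R \<in> vecs (dual v E)"
        using adjoint_in_bounded_ops[OF E H nontriv T] b
        by (intro vecs_diff[OF DE] vecs_sum[OF DE] vecs_smul[OF DE] a)
          (auto simp: bounded_ops_def linear_maps_def)
      ultimately show ?thesis
        using nrm_nonneg[OF DE, of ?R] K(2) by simp
    qed
    then show "\<exists>N0. \<forall>N\<ge>N0. norm (nrm (dual v E) (adjoint v H T b
      - (\<Sum>n<N. smul (dual v E) (evaluation H (y n) b) (a n))) - 0) < \<epsilon>"
      by blast
  qed
  show "nuclear_rep v (dual v H) (dual v E) p (adjoint v H T) (\<lambda>n. evaluation H (y n)) a"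
    unfolding nuclear_rep_def using ev a conv summw by blast
qed

end

section \<open>Adjoints of nuclear operators\<close>

theorem proposition2p12p3:
  fixes v :: "'f::field \<Rightarrow> real"
    and E :: "('f, 'e::ab_group_add) nspace"
    and H :: "('f, 'h::ab_group_add) nspace"
    and r :: ereal
    and T :: "'e \<Rightarrow> 'h"
  assumes "infinite (UNIV :: 'f set)"
    and "nonarch_valued_field v"
    and "nontrivial_valuation v"
    and "spherically_complete v"
    and "normed_space v E"
    and "normed_space v H"
    and "1 \<le> r"
    and "T \<in> nuclear_ops v r E H"
  shows "adjoint v H T \<in> nuclear_ops v r (dual v H) (dual v E)
    \<and> nu v r (dual v H) (dual v E) (adjoint v H T) \<le> nu v r E H T"
proof -
  interpret nonarch_valued_field v
    by fact
  note nontriv = assms(3) and E = assms(5) and H = assms(6)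
  have T: "T \<in> bounded_ops E H"
    using assms(8) by (auto simp: nuclear_ops_def split: if_splits)
  note adj = adjoint_bounded[OF E H nontriv T]
  show ?thesis
  proof (cases "r = \<infinity>")
    case True
    then show ?thesis
      using adj by (simp add: nuclear_ops_def nu_def)
  next
    case False
    define p where "p = real_of_ereal r"
    have p: "0 < p"
      using \<open>1 \<le> r\<close> False by (cases r) (auto simp: p_def one_ereal_def)
    note transpose = nuclear_rep_adjoint[OF E H nontriv T p]
    let ?U = "{(\<Sum>n. nrm (dual v E) (a n) powr p * nrm H (y n) powr p) | a y.
      nuclear_rep v E H p T a y}"
    let ?W = "{(\<Sum>n. nrm (dual v (dual v H)) (a n) powr p * nrm (dual v E) (y n) powr p) | a y.
      nuclear_rep v (dual v H) (dual v E) p (adjoint v H T) a y}"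
    obtain a0 y0 where rep0: "nuclear_rep v E H p T a0 y0"
      using assms(8) False by (auto simp: nuclear_ops_def p_def)
    have W_nonneg: "0 \<le> w" if "w \<in> ?W" for w
      using that by (auto simp: nuclear_rep_def intro!: suminf_nonneg)
    have W_ne: "?W \<noteq> {}"
      using transpose(1)[OF rep0] by blast
    have "Inf ?W \<le> Inf ?U"
    proof (rule cInf_mono)
      show "?U \<noteq> {}"
        using rep0 by blast
      show "bdd_below ?W"
        using W_nonneg by (rule bdd_belowI)
      fix u assume "u \<in> ?U"
      then obtain a y where rep: "nuclear_rep v E H p T a y"
        and u: "u = (\<Sum>n. nrm (dual v E) (a n) powr p * nrm H (y n) powr p)"
        by blast
      let ?w = "\<Sum>n. nrm (dual v (dual v H)) (evaluation H (y n)) powr p * nrm (dual v E) (a n) powr p"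
      have "?w \<in> ?W"
        by (intro CollectI exI conjI) (rule refl, rule transpose(1)[OF rep])
      moreover have "?w \<le> u"
        unfolding u by (rule transpose(2)[OF rep])
      ultimately show "\<exists>w\<in>?W. w \<le> u" ..
    qed
    moreover have "0 \<le> Inf ?W"
      using W_ne W_nonneg by (rule cInf_greatest)
    ultimately have "Inf ?W powr (1 / p) \<le> Inf ?U powr (1 / p)"
      using p by (intro powr_mono2) auto
    moreover have "adjoint v H T \<in> nuclear_ops v r (dual v H) (dual v E)"
      using False adj(1) transpose(1)[OF rep0] by (auto simp: nuclear_ops_def p_def)
    ultimately show ?thesis
      using False by (simp only: nu_def Let_def p_def if_False)
  qed
qed

end
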